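(* If $\Gamma\vdash_{\mathsf w}P$ is derivable (for some context $\Gamma$ and some level function), then $P$ terminates, i.e., there is no infinite sequence $P\xrightarrow{\tau}P_1\xrightarrow{\tau}P_2\xrightarrow{\tau}\cdots$.
   Context: The calculus $\pi_{\mathsf W}$. Processes: $P,Q ::= \overline{x}\langle y_1,y_2\rangle.P \mid x(y_1,y_2).P$ (linear input) $\mid\ !x(y_1,y_2).P$ (server) $\mid P\mid Q \mid (\nu x)P \mid \mathbf 0$; $\tilde y$ denotes a tuple. Labelled transition system with labels $\alpha ::= x(\tilde v) \mid \overline x\langle \tilde v\rangle \mid (\nu y,\tilde b)\overline x\langle\tilde v\rangle \mid \tau$: $x(\tilde y).P \xrightarrow{x(\tilde v)} P\{\tilde v/\tilde y\}$; $!x(\tilde y).P\xrightarrow{x(\tilde v)} !x(\tilde y).P \mid P\{\tilde v/\tilde y\}$; $\overline x\langle\tilde y\rangle.P\xrightarrow{\overline x\langle\tilde y\rangle}P$; if $P\xrightarrow{\alpha}P'$ and $\mathrm{bn}(\alpha)\cap\mathrm{fn}(Q)=\emptyset$ then $P\mid Q\xrightarrow{\alpha}P'\mid Q$; if $P\xrightarrow{\alpha}P'$ and $x\notin\mathrm{n}(\alpha)$ then $(\nu x)P\xrightarrow{\alpha}(\nu x)P'$; if $P\xrightarrow{(\nu\tilde b)\overline x\langle\tilde v\rangle}P'$ and $y\in\mathrm{fn}(\tilde v)\setminus\{\tilde b,x\}$ then $(\nu y)P\xrightarrow{(\nu y,\tilde b)\overline x\langle\tilde v\rangle}P'$; if $P\xrightarrow{(\nu\tilde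 b)\overline x\langle\tilde v\rangle}P'$ ($\tilde b$ possibly empty), $Q\xrightarrow{x(\tilde v)}Q'$ and $\tilde b\cap\mathrm{fn}(Q)=\emptyset$, then $P\mid Q\xrightarrow{\tau}(\nu\tilde b)(P'\mid Q')$; parallel rules apply symmetrically. Types: $V ::= \mathsf i^n[V_1,V_2]$ (linear input) $\mid \mathsf o^n[V_1,V_2]$ (linear output) $\mid \mathsf S^n[V]$ (unrestricted server) $\mid \mathsf C^n[V]$ (unrestricted client) $\mid \mathbf{unit}$, with weights $n\in\{1,2,\dots\}$. Duality: $\overline{\mathsf i^n[V_1,V_2]}=\mathsf o^n[\overline{V_1},\overline{V_2}]$, $\overline{\mathsf o^n[V_1,V_2]}=\mathsf i^n[\overline{V_1},\overline{V_2}]$, $\overline{\mathsf S^n[V]}=\mathsf C^n[\overline V]$, $\overline{\mathsf C^n[V]}=\mathsf S^n[\overline V]$, $\overline{\mathbf{unit}}=\mathbf{unit}$. Contexts: $\Gamma ::= \cdot \mid \Gamma,x:V\mid \Gamma,x::V$, where $x::V$ abbreviates $x:(V,\overline V)$ (pairing of two complementary endpoint types; $(V,\overline V)=(\overline V,V)$), each name at most once. $\mathrm{un}(T)$ holds iff $T$ is $\mathsf S^n[V]$, $\mathsf C^n[V]$ or $\mathbf{unit}$; an entry $x::V$ is unrestricted iff $\mathrm{un}(V)$; $\mathrm{un}(\Gamma)$ iff all entries of $\Gamma$ are unrestricted. Split $\Gamma=\Gamma_1\circ\Gamma_2$: $\emptyset=\emptyset\circ\emptyset$; and, given $\Gamma=\Gamma_1\circ\Gamma_2$: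 if $\mathrm{un}(T)$ then $\Gamma,x:T=(\Gamma_1,x:T)\circ(\Gamma_2,x:T)$; if $\mathrm{un}(V)$ then $\Gamma,x::V=(\Gamma_1,x::V)\circ(\Gamma_2,x::V)$; if $\neg\mathrm{un}(V)$ then $\Gamma,x::V=(\Gamma_1,x:V)\circ(\Gamma_2,x:\overline V)=(\Gamma_1,x::V)\circ\Gamma_2=\Gamma_1\circ(\Gamma_2,x::V)$; if $\neg\mathrm{un}(T)$ then $\Gamma,x:T=(\Gamma_1,x:T)\circ\Gamma_2=\Gamma_1\circ(\Gamma_2,x:T)$. A level function is $l:\mathcal N\to\mathbb N$ on names (bound names assumed pairwise distinct) with $l(x)=n$ if $x$ is assigned (by $:$ or $::$) one of $\mathsf i^n[\cdot,\cdot],\mathsf o^n[\cdot,\cdot],\mathsf S^n[\cdot],\mathsf C^n[\cdot]$, and $l(x)$ arbitrary if $x:\mathbf{unit}$. Active outputs: $\mathrm{os}(\overline x\langle\tilde y\rangle.P)=\{x\}\cup\mathrm{os}(P)$, $\mathrm{os}(x(\tilde y).P)=\mathrm{os}(P)$, $\mathrm{os}(P\mid Q)=\mathrm{os}(P)\cup\mathrm{os}(Q)$, $\mathrm{os}((\nu x)P)=\mathrm{os}(P)$, $\mathrm{os}(\mathbf 0)=\mathrm{os}(!x(\tilde y).P)=\emptyset$. Typing rules (judgments $\Gamma\vdash_{\mathsf w}P$ and $\Gamma\vdash_{\mathsf w}x:V$, relative to $l$): Var$_1$: $\mathrm{un}(\Gamma)\Rightarrow \Gamma,x:V\vdash x:V$.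 Var$_2$: $\mathrm{un}(\Gamma)\Rightarrow\Gamma,x::V\vdash x:V$. Nil: $\mathrm{un}(\Gamma)\Rightarrow\Gamma\vdash\mathbf 0$. Par: $\Gamma_1\vdash P,\ \Gamma_2\vdash Q\Rightarrow\Gamma_1\circ\Gamma_2\vdash P\mid Q$. Res: $\Gamma,x::V\vdash P\Rightarrow\Gamma\vdash(\nu x)P$. Lin-In$_1$: $\Gamma_1,x:\mathsf i^n[V_1,V_2]\vdash x:\mathsf i^n[V_1,V_2]$, $\Gamma_2,y_1:V_1,y_2:V_2\vdash P$, $l(x)=l(y_2)$ $\Rightarrow(\Gamma_1,x:\mathsf i^n[V_1,V_2])\circ\Gamma_2\vdash x(y_1,y_2).P$. Lin-In$_2$: $\Gamma_1,x:\mathsf S^n[V]\vdash x:\mathsf S^n[V]$, $\Gamma_2,x:\mathsf S^n[V],y_1:V,y_2:\mathbf{unit}\vdash P\Rightarrow(\Gamma_1,x:\mathsf S^n[V])\circ(\Gamma_2,x:\mathsf S^n[V])\vdash x(y_1,y_2).P$. Lin-In$_3$: $\Gamma,x::\mathsf S^n[V]\vdash x:\mathsf S^n[V]$, $\Gamma,x::\mathsf S^n[V],y_1:V,y_2:\mathbf{unit}\vdash P\Rightarrow\Gamma,x::\mathsf S^n[V]\vdash x(y_1,y_2).P$. Lin-Out: $\Gamma_1,x:\mathsf o^n[V_1,V_2]\vdash x:\mathsf o^n[V_1,V_2]$, $\Gamma_2,y_1:V_1\vdash y_1:V_1$, $\Gamma_3,y_2:V_2\vdash P$, $l(x)=l(y_2)$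 $\Rightarrow(\Gamma_1,x:\mathsf o^n[V_1,V_2])\circ(\Gamma_2,y_1:V_1)\circ(\Gamma_3,y_2::V_2)\vdash\overline x\langle y_1,y_2\rangle.P$. Un-Out$_1$: $\Gamma_1,x:\mathsf C^n[V]\vdash x:\mathsf C^n[V]$, $\Gamma_2,x:\mathsf C^n[V],y_1:V\vdash y_1:V$, $\Gamma_3,x:\mathsf C^n[V],y_2:\mathbf{unit}\vdash P$ $\Rightarrow(\Gamma_1,x:\mathsf C^n[V])\circ(\Gamma_2,x:\mathsf C^n[V],y_1:V)\circ(\Gamma_3,x:\mathsf C^n[V])\vdash\overline x\langle y_1,y_2\rangle.P$. Un-Out$_2$: the same with every $x:\mathsf C^n[V]$ replaced by $x::\mathsf C^n[V]$. Un-In$_1$: $\Gamma,x:\mathsf S^n[V]\vdash x:\mathsf S^n[V]$, $\Gamma,x:\mathsf S^n[V],y_1:V,y_2:\mathbf{unit}\vdash P$, and $l(b)<n$ for all $b\in\mathrm{os}(P)$ $\Rightarrow\Gamma,x:\mathsf S^n[V]\vdash\ !x(y_1,y_2).P$. Un-In$_2$: the same with $x::\mathsf S^n[V]$ in place of $x:\mathsf S^n[V]$. $\Gamma\vdash_{\mathsf w}P$ holds if it is derivable for some level function. *)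

theory Defs
  imports "HOL-Library.Finite_Map" "HOL-Library.Uprod"
begin

section \<open>Processes\<close>

type_synonym name = nat

datatype proc =
    Out name name name proc
  | In name name name proc
  | Srv name name name proc
  | Par proc proc
  | Res name proc
  | PNil

primrec fn :: "proc \<Rightarrow> name set" where
  "fn (Out x y1 y2 P) = {x, y1, y2} \<union> fn P"
| "fn (In x y1 y2 P) = {x} \<union> (fn P - {y1, y2})"
| "fn (Srv x y1 y2 P) = {x} \<union> (fn P - {y1, y2})"
| "fn (Par P Q) = fn P \<union> fn Q"
| "fn (Res x P) = fn P - {x}"
| "fn PNil = {}"

text \<open>All binding occurrences, with multiplicity.\<close>

primrec binders :: "proc \<Rightarrow> name list" where
  "binders (Out x y1 y2 P) = binders P"
| "binders (In x y1 y2 P) = y1 # y2 # binders P"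
| "binders (Srv x y1 y2 P) = y1 # y2 # binders P"
| "binders (Par P Q) = binders P @ binders Q"
| "binders (Res x P) = x # binders P"
| "binders PNil = []"

text \<open>Capture-avoiding simultaneous substitution. A binder \<open>z\<close> is kept unless it would capture
  a substituted name; only then is it replaced by a fresh one.\<close>

definition pick :: "name \<Rightarrow> name set \<Rightarrow> name" where
  "pick z A = (if z \<notin> A then z else (LEAST z'. z' \<notin> A))"

primrec subst :: "(name \<Rightarrow> name) \<Rightarrow> proc \<Rightarrow> proc" where
  "subst \<sigma> (Out x y1 y2 P) = Out (\<sigma> x) (\<sigma> y1) (\<sigma> y2) (subst \<sigma> P)"
| "subst \<sigma> (In x y1 y2 P) =
    (let A = \<sigma> ` (fn P - {y1, y2}); z1 = pick y1 A; z2 = pick y2 (insert z1 A)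
     in In (\<sigma> x) z1 z2 (subst (\<sigma>(y1 := z1, y2 := z2)) P))"
| "subst \<sigma> (Srv x y1 y2 P) =
    (let A = \<sigma> ` (fn P - {y1, y2}); z1 = pick y1 A; z2 = pick y2 (insert z1 A)
     in Srv (\<sigma> x) z1 z2 (subst (\<sigma>(y1 := z1, y2 := z2)) P))"
| "subst \<sigma> (Par P Q) = Par (subst \<sigma> P) (subst \<sigma> Q)"
| "subst \<sigma> (Res x P) =
    (let z = pick x (\<sigma> ` (fn P - {x})) in Res z (subst (\<sigma>(x := z)) P))"
| "subst \<sigma> PNil = PNil"

abbreviation subst1 :: "proc \<Rightarrow> name \<Rightarrow> name \<Rightarrow> proc" where
  "subst1 P y v \<equiv> subst (id(y := v)) P"

abbreviation subst2 :: "proc \<Rightarrow> name \<Rightarrow> name \<Rightarrow> name \<Rightarrow> name \<Rightarrow> proc" where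
  "subst2 P y1 y2 v1 v2 \<equiv> subst (id(y1 := v1, y2 := v2)) P"

inductive alpha :: "proc \<Rightarrow> proc \<Rightarrow> bool" (infix "\<approx>\<^sub>\<alpha>" 50) where
  alpha_refl: "P \<approx>\<^sub>\<alpha> P"
| alpha_sym: "P \<approx>\<^sub>\<alpha> Q \<Longrightarrow> Q \<approx>\<^sub>\<alpha> P"
| alpha_trans: "P \<approx>\<^sub>\<alpha> Q \<Longrightarrow> Q \<approx>\<^sub>\<alpha> R \<Longrightarrow> P \<approx>\<^sub>\<alpha> R"
| alpha_Out: "P \<approx>\<^sub>\<alpha> Q \<Longrightarrow> Out x y1 y2 P \<approx>\<^sub>\<alpha> Out x y1 y2 Q"
| alpha_In: "P \<approx>\<^sub>\<alpha> Q \<Longrightarrow> In x y1 y2 P \<approx>\<^sub>\<alpha> In x y1 y2 Q"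
| alpha_Srv: "P \<approx>\<^sub>\<alpha> Q \<Longrightarrow> Srv x y1 y2 P \<approx>\<^sub>\<alpha> Srv x y1 y2 Q"
| alpha_Par: "P \<approx>\<^sub>\<alpha> P' \<Longrightarrow> Q \<approx>\<^sub>\<alpha> Q' \<Longrightarrow> Par P Q \<approx>\<^sub>\<alpha> Par P' Q'"
| alpha_Res: "P \<approx>\<^sub>\<alpha> Q \<Longrightarrow> Res x P \<approx>\<^sub>\<alpha> Res x Q"
| rename_In: "y1 \<noteq> y2 \<Longrightarrow> z1 \<noteq> z2 \<Longrightarrow> {z1, z2} \<inter> (fn P - {y1, y2}) = {} \<Longrightarrow>
    In x y1 y2 P \<approx>\<^sub>\<alpha> In x z1 z2 (subst2 P y1 y2 z1 z2)"
| rename_Srv: "y1 \<noteq> y2 \<Longrightarrow> z1 \<noteq> z2 \<Longrightarrow> {z1, z2} \<inter> (fn P - {y1, y2}) = {} \<Longrightarrow>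
    Srv x y1 y2 P \<approx>\<^sub>\<alpha> Srv x z1 z2 (subst2 P y1 y2 z1 z2)"
| rename_Res: "z \<notin> fn P - {x} \<Longrightarrow> Res x P \<approx>\<^sub>\<alpha> Res z (subst1 P x z)"

section \<open>Labelled transitions\<close>

text \<open>\<open>LOut bs x v1 v2\<close> is the output of \<open>v1, v2\<close> on \<open>x\<close> extruding the names \<open>bs\<close>;
  it is the free output when \<open>bs = []\<close>.\<close>

datatype label =
    LIn name name name
  | LOut "name list" name name name
  | Tau

primrec bn_label :: "label \<Rightarrow> name set" where
  "bn_label (LIn x v1 v2) = {}"
| "bn_label (LOut bs x v1 v2) = set bs"
| "bn_label Tau = {}"

primrec n_label :: "label \<Rightarrow> name set" where
  "n_label (LIn x v1 v2) = {x, v1, v2}"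
| "n_label (LOut bs x v1 v2) = set bs \<union> {x, v1, v2}"
| "n_label Tau = {}"

abbreviation Ress :: "name list \<Rightarrow> proc \<Rightarrow> proc" where
  "Ress bs P \<equiv> foldr Res bs P"

text \<open>Processes are considered up to renaming of bound names; on raw terms this is the rule
  \<open>tr_alpha\<close>, without which the side conditions on bound names could block transitions.\<close>

inductive trans :: "proc \<Rightarrow> label \<Rightarrow> proc \<Rightarrow> bool" ("_ \<midarrow>_\<rightarrow> _" [51, 0, 51] 50) where
  tr_in: "In x y1 y2 P \<midarrow>LIn x v1 v2\<rightarrow> subst2 P y1 y2 v1 v2"
| tr_srv: "Srv x y1 y2 P \<midarrow>LIn x v1 v2\<rightarrow> Par (Srv x y1 y2 P) (subst2 P y1 y2 v1 v2)"
| tr_out: "Out x y1 y2 P \<midarrow>LOut [] x y1 y2\<rightarrow> P"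
| tr_parL: "P \<midarrow>a\<rightarrow> P' \<Longrightarrow> bn_label a \<inter> fn Q = {} \<Longrightarrow> Par P Q \<midarrow>a\<rightarrow> Par P' Q"
| tr_parR: "Q \<midarrow>a\<rightarrow> Q' \<Longrightarrow> bn_label a \<inter> fn P = {} \<Longrightarrow> Par P Q \<midarrow>a\<rightarrow> Par P Q'"
| tr_res: "P \<midarrow>a\<rightarrow> P' \<Longrightarrow> x \<notin> n_label a \<Longrightarrow> Res x P \<midarrow>a\<rightarrow> Res x P'"
| tr_open: "P \<midarrow>LOut bs x v1 v2\<rightarrow> P' \<Longrightarrow> y \<in> {v1, v2} - (set bs \<union> {x}) \<Longrightarrow>
    Res y P \<midarrow>LOut (y # bs) x v1 v2\<rightarrow> P'"
| tr_comL: "P \<midarrow>LOut bs x v1 v2\<rightarrow> P' \<Longrightarrow> Q \<midarrow>LIn x v1 v2\<rightarrow> Q' \<Longrightarrow> set bs \<inter> fn Q = {} \<Longrightarrow>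
    Par P Q \<midarrow>Tau\<rightarrow> Ress bs (Par P' Q')"
| tr_comR: "P \<midarrow>LIn x v1 v2\<rightarrow> P' \<Longrightarrow> Q \<midarrow>LOut bs x v1 v2\<rightarrow> Q' \<Longrightarrow> set bs \<inter> fn P = {} \<Longrightarrow>
    Par P Q \<midarrow>Tau\<rightarrow> Ress bs (Par P' Q')"
| tr_alpha: "P \<approx>\<^sub>\<alpha> Q \<Longrightarrow> Q \<midarrow>a\<rightarrow> Q' \<Longrightarrow> P \<midarrow>a\<rightarrow> Q'"

definition terminates :: "proc \<Rightarrow> bool" where
  "terminates P \<longleftrightarrow> \<not> (\<exists>f :: nat \<Rightarrow> proc. f 0 = P \<and> (\<forall>i. f i \<midarrow>Tau\<rightarrow> f (Suc i)))"

section \<open>Types and contexts\<close>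

typedef weight = "{n :: nat. 1 \<le> n}" morphisms nat_of_weight Weight
  by auto

datatype ty =
    InT weight ty ty
  | OutT weight ty ty
  | ServerT weight ty
  | ClientT weight ty
  | UnitT

primrec dual :: "ty \<Rightarrow> ty" where
  "dual (InT n V1 V2) = OutT n (dual V1) (dual V2)"
| "dual (OutT n V1 V2) = InT n (dual V1) (dual V2)"
| "dual (ServerT n V) = ClientT n (dual V)"
| "dual (ClientT n V) = ServerT n (dual V)"
| "dual UnitT = UnitT"

primrec un :: "ty \<Rightarrow> bool" where
  "un (InT n V1 V2) = False"
| "un (OutT n V1 V2) = False"
| "un (ServerT n V) = True"
| "un (ClientT n V) = True"
| "un UnitT = True"

primrec level_of :: "ty \<Rightarrow> nat option" where
  "level_of (InT n V1 V2) = Some (nat_of_weight n)"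
| "level_of (OutT n V1 V2) = Some (nat_of_weight n)"
| "level_of (ServerT n V) = Some (nat_of_weight n)"
| "level_of (ClientT n V) = Some (nat_of_weight n)"
| "level_of UnitT = None"

text \<open>The entry \<open>x :: V\<close> abbreviates the pairing of \<open>V\<close> with its dual, in either order, hence the
  unordered pair. Entries pairing types that are not dual to each other are never unrestricted and
  never arise from splitting, so they occur in no derivable judgement.\<close>

datatype entry = One ty | Two "ty uprod"

abbreviation Both :: "ty \<Rightarrow> entry" where
  "Both V \<equiv> Two (Upair V (dual V))"

type_synonym ctx = "(name, entry) fmap"

abbreviation ext_one :: "ctx \<Rightarrow> name \<Rightarrow> ty \<Rightarrow> ctx" ("_ \<lhd> _ \<mapsto> _" [65, 66, 66] 65) where
  "\<Gamma> \<lhd> x \<mapsto> V \<equiv> fmupd x (One V) \<Gamma>"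

abbreviation ext_both :: "ctx \<Rightarrow> name \<Rightarrow> ty \<Rightarrow> ctx" ("_ \<lhd> _ \<mapsto>\<^sub>2 _" [65, 66, 66] 65) where
  "\<Gamma> \<lhd> x \<mapsto>\<^sub>2 V \<equiv> fmupd x (Both V) \<Gamma>"

text \<open>Each name occurs at most once in a context: this is the side condition that makes
  an extension of \<open>\<Gamma>\<close> by the names \<open>xs\<close> a context.\<close>

definition new :: "name list \<Rightarrow> ctx \<Rightarrow> bool" where
  "new xs \<Gamma> \<longleftrightarrow> distinct xs \<and> set xs \<inter> fmdom' \<Gamma> = {}"

definition un_entry :: "entry \<Rightarrow> bool" where
  "un_entry e \<longleftrightarrow> (\<exists>V. (e = One V \<or> e = Both V) \<and> un V)"

definition un_ctx :: "ctx \<Rightarrow> bool" where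
  "un_ctx \<Gamma> \<longleftrightarrow> (\<forall>x e. fmlookup \<Gamma> x = Some e \<longrightarrow> un_entry e)"

text \<open>\<open>split \<Gamma> \<Gamma>1 \<Gamma>2\<close> stands for \<open>\<Gamma> = \<Gamma>1 \<circ> \<Gamma>2\<close>.\<close>

inductive split :: "ctx \<Rightarrow> ctx \<Rightarrow> ctx \<Rightarrow> bool" where
  split_empty: "split fmempty fmempty fmempty"
| split_un_one: "split \<Gamma> \<Gamma>1 \<Gamma>2 \<Longrightarrow> new [x] \<Gamma> \<Longrightarrow> un T \<Longrightarrow>
    split (\<Gamma> \<lhd> x \<mapsto> T) (\<Gamma>1 \<lhd> x \<mapsto> T) (\<Gamma>2 \<lhd> x \<mapsto> T)"
| split_un_both: "split \<Gamma> \<Gamma>1 \<Gamma>2 \<Longrightarrow> new [x] \<Gamma> \<Longrightarrow> un V \<Longrightarrow>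
    split (\<Gamma> \<lhd> x \<mapsto>\<^sub>2 V) (\<Gamma>1 \<lhd> x \<mapsto>\<^sub>2 V) (\<Gamma>2 \<lhd> x \<mapsto>\<^sub>2 V)"
| split_lin_both: "split \<Gamma> \<Gamma>1 \<Gamma>2 \<Longrightarrow> new [x] \<Gamma> \<Longrightarrow> \<not> un V \<Longrightarrow>
    split (\<Gamma> \<lhd> x \<mapsto>\<^sub>2 V) (\<Gamma>1 \<lhd> x \<mapsto> V) (\<Gamma>2 \<lhd> x \<mapsto> dual V)"
| split_lin_both_left: "split \<Gamma> \<Gamma>1 \<Gamma>2 \<Longrightarrow> new [x] \<Gamma> \<Longrightarrow> \<not> un V \<Longrightarrow>
    split (\<Gamma> \<lhd> x \<mapsto>\<^sub>2 V) (\<Gamma>1 \<lhd> x \<mapsto>\<^sub>2 V) \<Gamma>2"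
| split_lin_both_right: "split \<Gamma> \<Gamma>1 \<Gamma>2 \<Longrightarrow> new [x] \<Gamma> \<Longrightarrow> \<not> un V \<Longrightarrow>
    split (\<Gamma> \<lhd> x \<mapsto>\<^sub>2 V) \<Gamma>1 (\<Gamma>2 \<lhd> x \<mapsto>\<^sub>2 V)"
| split_lin_one_left: "split \<Gamma> \<Gamma>1 \<Gamma>2 \<Longrightarrow> new [x] \<Gamma> \<Longrightarrow> \<not> un T \<Longrightarrow>
    split (\<Gamma> \<lhd> x \<mapsto> T) (\<Gamma>1 \<lhd> x \<mapsto> T) \<Gamma>2"
| split_lin_one_right: "split \<Gamma> \<Gamma>1 \<Gamma>2 \<Longrightarrow> new [x] \<Gamma> \<Longrightarrow> \<not> un T \<Longrightarrow>
    split (\<Gamma> \<lhd> x \<mapsto> T) \<Gamma>1 (\<Gamma>2 \<lhd> x \<mapsto> T)"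

definition split3 :: "ctx \<Rightarrow> ctx \<Rightarrow> ctx \<Rightarrow> ctx \<Rightarrow> bool" where
  "split3 \<Gamma> \<Gamma>1 \<Gamma>2 \<Gamma>3 \<longleftrightarrow> (\<exists>\<Delta>. split \<Gamma> \<Delta> \<Gamma>3 \<and> split \<Delta> \<Gamma>1 \<Gamma>2)"

section \<open>Typing\<close>

primrec os :: "proc \<Rightarrow> name set" where
  "os (Out x y1 y2 P) = {x} \<union> os P"
| "os (In x y1 y2 P) = os P"
| "os (Srv x y1 y2 P) = {}"
| "os (Par P Q) = os P \<union> os Q"
| "os (Res x P) = os P"
| "os PNil = {}"

text \<open>\<open>l\<close> is a level function for \<open>\<Gamma>\<close>; names of type unit are unconstrained. It is required of every
  context in a derivation, so that \<open>l\<close> also fits the types assigned to bound names.\<close>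

definition levels :: "(name \<Rightarrow> nat) \<Rightarrow> ctx \<Rightarrow> bool" where
  "levels l \<Gamma> \<longleftrightarrow> (\<forall>x V n. (fmlookup \<Gamma> x = Some (One V) \<or> fmlookup \<Gamma> x = Some (Both V)) \<longrightarrow>
    level_of V = Some n \<longrightarrow> l x = n)"

inductive typed_name :: "(name \<Rightarrow> nat) \<Rightarrow> ctx \<Rightarrow> name \<Rightarrow> ty \<Rightarrow> bool"
  for l :: "name \<Rightarrow> nat" where
  Var1: "un_ctx \<Gamma> \<Longrightarrow> new [x] \<Gamma> \<Longrightarrow> levels l (\<Gamma> \<lhd> x \<mapsto> V) \<Longrightarrow> typed_name l (\<Gamma> \<lhd> x \<mapsto> V) x V"
| Var2: "un_ctx \<Gamma> \<Longrightarrow> new [x] \<Gamma> \<Longrightarrow> levels l (\<Gamma> \<lhd> x \<mapsto>\<^sub>2 V) \<Longrightarrow> typed_name l (\<Gamma> \<lhd> x \<mapsto>\<^sub>2 V) x V"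

inductive typed :: "(name \<Rightarrow> nat) \<Rightarrow> ctx \<Rightarrow> proc \<Rightarrow> bool"
  for l :: "name \<Rightarrow> nat" where
  T_Nil: "\<lbrakk>un_ctx \<Gamma>; levels l \<Gamma>\<rbrakk> \<Longrightarrow> typed l \<Gamma> PNil"
| T_Par: "\<lbrakk>typed l \<Gamma>1 P; typed l \<Gamma>2 Q; split \<Gamma> \<Gamma>1 \<Gamma>2; levels l \<Gamma>\<rbrakk> \<Longrightarrow> typed l \<Gamma> (Par P Q)"
| T_Res: "\<lbrakk>new [x] \<Gamma>; typed l (\<Gamma> \<lhd> x \<mapsto>\<^sub>2 V) P; levels l \<Gamma>\<rbrakk> \<Longrightarrow> typed l \<Gamma> (Res x P)"
| Lin_In1: "\<lbrakk>new [x] \<Gamma>1; new [y1, y2] \<Gamma>2;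
    typed_name l (\<Gamma>1 \<lhd> x \<mapsto> InT n V1 V2) x (InT n V1 V2);
    typed l (\<Gamma>2 \<lhd> y1 \<mapsto> V1 \<lhd> y2 \<mapsto> V2) P;
    l x = l y2;
    split \<Gamma> (\<Gamma>1 \<lhd> x \<mapsto> InT n V1 V2) \<Gamma>2; levels l \<Gamma>\<rbrakk>
    \<Longrightarrow> typed l \<Gamma> (In x y1 y2 P)"
| Lin_In2: "\<lbrakk>new [x] \<Gamma>1; new [x, y1, y2] \<Gamma>2;
    typed_name l (\<Gamma>1 \<lhd> x \<mapsto> ServerT n V) x (ServerT n V);
    typed l (\<Gamma>2 \<lhd> x \<mapsto> ServerT n V \<lhd> y1 \<mapsto> V \<lhd> y2 \<mapsto> UnitT) P;
    split \<Gamma> (\<Gamma>1 \<lhd> x \<mapsto> ServerT n V) (\<Gamma>2 \<lhd> x \<mapsto> ServerT n V); levels l \<Gamma>\<rbrakk>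
    \<Longrightarrow> typed l \<Gamma> (In x y1 y2 P)"
| Lin_In3: "\<lbrakk>new [x, y1, y2] \<Gamma>;
    typed_name l (\<Gamma> \<lhd> x \<mapsto>\<^sub>2 ServerT n V) x (ServerT n V);
    typed l (\<Gamma> \<lhd> x \<mapsto>\<^sub>2 ServerT n V \<lhd> y1 \<mapsto> V \<lhd> y2 \<mapsto> UnitT) P;
    levels l (\<Gamma> \<lhd> x \<mapsto>\<^sub>2 ServerT n V)\<rbrakk>
    \<Longrightarrow> typed l (\<Gamma> \<lhd> x \<mapsto>\<^sub>2 ServerT n V) (In x y1 y2 P)"
| Lin_Out: "\<lbrakk>new [x] \<Gamma>1; new [y1] \<Gamma>2; new [y2] \<Gamma>3;
    typed_name l (\<Gamma>1 \<lhd> x \<mapsto> OutT n V1 V2) x (OutT n V1 V2);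
    typed_name l (\<Gamma>2 \<lhd> y1 \<mapsto> V1) y1 V1;
    typed l (\<Gamma>3 \<lhd> y2 \<mapsto> V2) P;
    l x = l y2;
    split3 \<Gamma> (\<Gamma>1 \<lhd> x \<mapsto> OutT n V1 V2) (\<Gamma>2 \<lhd> y1 \<mapsto> V1) (\<Gamma>3 \<lhd> y2 \<mapsto>\<^sub>2 V2); levels l \<Gamma>\<rbrakk>
    \<Longrightarrow> typed l \<Gamma> (Out x y1 y2 P)"
| Un_Out1: "\<lbrakk>new [x] \<Gamma>1; new [x, y1] \<Gamma>2; new [x, y2] \<Gamma>3;
    typed_name l (\<Gamma>1 \<lhd> x \<mapsto> ClientT n V) x (ClientT n V);
    typed_name l (\<Gamma>2 \<lhd> x \<mapsto> ClientT n V \<lhd> y1 \<mapsto> V) y1 V;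
    typed l (\<Gamma>3 \<lhd> x \<mapsto> ClientT n V \<lhd> y2 \<mapsto> UnitT) P;
    split3 \<Gamma> (\<Gamma>1 \<lhd> x \<mapsto> ClientT n V) (\<Gamma>2 \<lhd> x \<mapsto> ClientT n V \<lhd> y1 \<mapsto> V)
      (\<Gamma>3 \<lhd> x \<mapsto> ClientT n V);
    levels l \<Gamma>\<rbrakk>
    \<Longrightarrow> typed l \<Gamma> (Out x y1 y2 P)"
| Un_Out2: "\<lbrakk>new [x] \<Gamma>1; new [x, y1] \<Gamma>2; new [x, y2] \<Gamma>3;
    typed_name l (\<Gamma>1 \<lhd> x \<mapsto>\<^sub>2 ClientT n V) x (ClientT n V);
    typed_name l (\<Gamma>2 \<lhd> x \<mapsto>\<^sub>2 ClientT n V \<lhd> y1 \<mapsto> V) y1 V;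
    typed l (\<Gamma>3 \<lhd> x \<mapsto>\<^sub>2 ClientT n V \<lhd> y2 \<mapsto> UnitT) P;
    split3 \<Gamma> (\<Gamma>1 \<lhd> x \<mapsto>\<^sub>2 ClientT n V) (\<Gamma>2 \<lhd> x \<mapsto>\<^sub>2 ClientT n V \<lhd> y1 \<mapsto> V)
      (\<Gamma>3 \<lhd> x \<mapsto>\<^sub>2 ClientT n V);
    levels l \<Gamma>\<rbrakk>
    \<Longrightarrow> typed l \<Gamma> (Out x y1 y2 P)"
| Un_In1: "\<lbrakk>new [x, y1, y2] \<Gamma>;
    typed_name l (\<Gamma> \<lhd> x \<mapsto> ServerT n V) x (ServerT n V);
    typed l (\<Gamma> \<lhd> x \<mapsto> ServerT n V \<lhd> y1 \<mapsto> V \<lhd> y2 \<mapsto> UnitT) P;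
    \<forall>b \<in> os P. l b < nat_of_weight n;
    levels l (\<Gamma> \<lhd> x \<mapsto> ServerT n V)\<rbrakk>
    \<Longrightarrow> typed l (\<Gamma> \<lhd> x \<mapsto> ServerT n V) (Srv x y1 y2 P)"
| Un_In2: "\<lbrakk>new [x, y1, y2] \<Gamma>;
    typed_name l (\<Gamma> \<lhd> x \<mapsto>\<^sub>2 ServerT n V) x (ServerT n V);
    typed l (\<Gamma> \<lhd> x \<mapsto>\<^sub>2 ServerT n V \<lhd> y1 \<mapsto> V \<lhd> y2 \<mapsto> UnitT) P;
    \<forall>b \<in> os P. l b < nat_of_weight n;
    levels l (\<Gamma> \<lhd> x \<mapsto>\<^sub>2 ServerT n V)\<rbrakk>
    \<Longrightarrow> typed l (\<Gamma> \<lhd> x \<mapsto>\<^sub>2 ServerT n V) (Srv x y1 y2 P)"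

text \<open>Levels are assigned to names, so derivations are built for a representative whose bound names
  are pairwise distinct and different from its free names.\<close>

definition distinct_binders :: "proc \<Rightarrow> bool" where
  "distinct_binders P \<longleftrightarrow> distinct (binders P) \<and> set (binders P) \<inter> fn P = {}"

definition typable :: "ctx \<Rightarrow> proc \<Rightarrow> bool" (infix "\<turnstile>\<^sub>w" 50) where
  "\<Gamma> \<turnstile>\<^sub>w P \<longleftrightarrow> (\<exists>P' l. P \<approx>\<^sub>\<alpha> P' \<and> distinct_binders P' \<and> typed l \<Gamma> P')"

end

theory Submission
  imports Defs "HOL-Library.Multiset"
begin

text \<open>Every reduction consumes an active output on some name \<open>x\<close> of level \<open>n\<close> and releases at most
  the active outputs of a server body at \<open>x\<close>, all of level below \<open>n\<close>; so the multiset of levels of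
  active outputs decreases. For this it is irrelevant who owns which endpoint of a channel: it
  suffices that each name carries a type up to duality, with the linear and the unrestricted
  channels identified (the second component of the latter being unit). Unit names are never used as
  channels, so any name may be passed where a unit name is expected. This matters because rules
  \<open>Un_Out1\<close> and \<open>Un_Out2\<close> use \<open>y2\<close> at type unit whatever its type is elsewhere.\<close>

section \<open>Sorts and the weight of a process\<close>

datatype sort = Unit | Chan nat sort sort

primrec sort_of :: "ty \<Rightarrow> sort" where
  "sort_of (InT n V1 V2) = Chan (nat_of_weight n) (sort_of V1) (sort_of V2)"
| "sort_of (OutT n V1 V2) = Chan (nat_of_weight n) (sort_of V1) (sort_of V2)"
| "sort_of (ServerT n V) = Chan (nat_of_weight n) (sort_of V) Unit"
| "sort_of (ClientT n V) = Chan (nat_of_weight n) (sort_of V) Unit"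
| "sort_of UnitT = Unit"

text \<open>One-sided: the first sort is what a name carries, the second what its use demands. Only
  a demand for \<open>Unit\<close> leaves slack.\<close>

definition fits :: "sort \<Rightarrow> sort \<Rightarrow> bool" where
  "fits S A \<longleftrightarrow> A = Unit \<or> S = A"

lemma fits_refl [simp]: "fits S S"
  by (simp add: fits_def)

lemma fits_Unit [simp]: "fits S Unit"
  by (simp add: fits_def)

lemma fits_Chan [simp]: "fits S (Chan n A B) \<longleftrightarrow> S = Chan n A B"
  by (simp add: fits_def)

lemma fits_trans: "fits S T \<Longrightarrow> fits T U \<Longrightarrow> fits S U"
  by (auto simp: fits_def)

type_synonym env = "name \<Rightarrow> sort"

text \<open>\<open>M\<close> collects the levels of the active outputs; it is an argument of the relation, not a
  function of the process, because the sorts of restricted names are not recorded in processes.\<close>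

inductive weighs :: "env \<Rightarrow> proc \<Rightarrow> nat multiset \<Rightarrow> bool" where
  weighs_Nil: "weighs E PNil {#}"
| weighs_Par: "weighs E P M \<Longrightarrow> weighs E Q N \<Longrightarrow> weighs E (Par P Q) (M + N)"
| weighs_Res: "weighs (E(x := S)) P M \<Longrightarrow> weighs E (Res x P) M"
| weighs_Out: "E x = Chan n A B \<Longrightarrow> fits (E y1) A \<Longrightarrow> fits (E y2) B \<Longrightarrow> weighs E P M \<Longrightarrow>
    weighs E (Out x y1 y2 P) (add_mset n M)"
| weighs_In: "E x = Chan n A B \<Longrightarrow> weighs (E(y1 := A, y2 := B)) P M \<Longrightarrow>
    weighs E (In x y1 y2 P) M"
| weighs_Srv: "E x = Chan n A B \<Longrightarrow> weighs (E(y1 := A, y2 := B)) P M \<Longrightarrow> \<forall>m \<in># M. m < n \<Longrightarrow>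
    weighs E (Srv x y1 y2 P) {#}"

inductive_cases weighs_ParE: "weighs E (Par P Q) M"
inductive_cases weighs_ResE: "weighs E (Res x P) M"
inductive_cases weighs_OutE: "weighs E (Out x y1 y2 P) M"
inductive_cases weighs_InE: "weighs E (In x y1 y2 P) M"
inductive_cases weighs_SrvE: "weighs E (Srv x y1 y2 P) M"
inductive_cases weighs_NilE: "weighs E PNil M"

text \<open>A subject carries a \<open>Chan\<close> sort, on which \<open>fits\<close> is equality,
  so a refinement only touches names of sort \<open>Unit\<close>. For objects, transitivity of
  \<open>fits\<close> suffices, and binders get the same sort in both environments.\<close>

lemma weighs_mono:
  assumes "weighs E P M" and "\<forall>x \<in> fn P. fits (E' x) (E x)"
  shows "weighs E' P M"
  using assms
proof (induction arbitrary: E' rule: weighs.induct)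
  case (weighs_Res E x S P M)
  have "weighs (E'(x := S)) P M" using weighs_Res by auto
  then show ?case by (rule weighs.weighs_Res)
next
  case (weighs_Out E x n A B y1 y2 P M)
  then show ?case by (intro weighs.weighs_Out[of _ _ _ A B]) (auto intro: fits_trans)
next
  case (weighs_In E x n A B y1 y2 P M)
  have "weighs (E'(y1 := A, y2 := B)) P M" using weighs_In by auto
  moreover have "E' x = Chan n A B" using weighs_In by simp
  ultimately show ?case by (blast intro: weighs.weighs_In)
next
  case (weighs_Srv E x n A B y1 y2 P M)
  have "weighs (E'(y1 := A, y2 := B)) P M" using weighs_Srv by auto
  moreover have "E' x = Chan n A B" using weighs_Srv by simp
  ultimately show ?case using weighs_Srv.hyps by (blast intro: weighs.weighs_Srv)
qed (auto intro: weighs.intros)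

lemma weighs_cong:
  assumes "weighs E P M" and "\<And>x. x \<in> fn P \<Longrightarrow> E' x = E x"
  shows "weighs E' P M"
  using assms by (auto intro: weighs_mono)

section \<open>Substitution and renaming\<close>

lemma finite_fn [simp]: "finite (fn P)"
  by (induction P) auto

lemma pick_notin: "finite A \<Longrightarrow> pick z A \<notin> A"
  by (metis ex_new_if_finite infinite_UNIV_nat LeastI pick_def)

text \<open>\<open>z1\<close> and \<open>z2\<close> avoid each other and the images of the other
  free names, so updating \<open>E'\<close> at them disturbs nothing else. When
  \<open>y1 = y2\<close>, the later update wins on both sides.\<close>

lemma pick_binders:
  assumes "finite F" and "A = \<sigma> ` (F - {y1, y2})"
    and "z1 = pick y1 A" and "z2 = pick y2 (insert z1 A)"
  shows "\<forall>w \<in> F. (E'(z1 := S, z2 := T)) ((\<sigma>(y1 := z1, y2 := z2)) w)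
    = (if w = y2 then T else if w = y1 then S else E' (\<sigma> w))"
proof -
  have "finite A" using assms(1,2) by simp
  then have "z1 \<notin> A" "z2 \<notin> insert z1 A"
    using assms(3,4) pick_notin[of A] pick_notin[of "insert z1 A"] by auto
  then show ?thesis using assms(2) by auto
qed

lemma pick_binder:
  assumes "finite F" and "z = pick x (\<sigma> ` (F - {x}))"
  shows "\<forall>w \<in> F. (E'(z := S)) ((\<sigma>(x := z)) w) = (if w = x then S else E' (\<sigma> w))"
proof -
  have "z \<notin> \<sigma> ` (F - {x})" using assms pick_notin by simp
  then show ?thesis by auto
qed

text \<open>Every subject keeps its sort, hence its level. Both \<open>\<sigma>\<close> and
  \<open>E'\<close> are generalized because passing under a binder changes both. \<open>fits\<close>
  admits a name of any sort for a parameter of sort \<open>Unit\<close>.\<close>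

lemma weighs_subst:
  assumes "weighs E P M" and "\<forall>x \<in> fn P. fits (E' (\<sigma> x)) (E x)"
  shows "weighs E' (subst \<sigma> P) M"
  using assms
proof (induction arbitrary: E' \<sigma> rule: weighs.induct)
  case (weighs_Res E x S P M)
  define z where "z = pick x (\<sigma> ` (fn P - {x}))"
  have "weighs (E'(z := S)) (subst (\<sigma>(x := z)) P) M"
    using weighs_Res.prems pick_binder[OF finite_fn z_def, where E' = E' and S = S] by (intro weighs_Res.IH) auto
  then show ?case by (auto simp: z_def[symmetric] Let_def intro: weighs.weighs_Res)
next
  case (weighs_Out E x n A B y1 y2 P M)
  then show ?case by (auto intro!: weighs.weighs_Out[of _ _ _ A B] intro: fits_trans)
next
  case (weighs_In E x n A B y1 y2 P M)
  define F where "F = \<sigma> ` (fn P - {y1, y2})"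
  define z1 where "z1 = pick y1 F"
  define z2 where "z2 = pick y2 (insert z1 F)"
  have "weighs (E'(z1 := A, z2 := B)) (subst (\<sigma>(y1 := z1, y2 := z2)) P) M"
    using weighs_In.prems pick_binders[OF finite_fn F_def z1_def z2_def, where E' = E']
    by (intro weighs_In.IH) auto
  moreover have "E' (\<sigma> x) = Chan n A B" using weighs_In by simp
  ultimately show ?case
    unfolding subst.simps Let_def F_def[symmetric] z1_def[symmetric] z2_def[symmetric]
    by (blast intro: weighs.weighs_In)
next
  case (weighs_Srv E x n A B y1 y2 P M)
  define F where "F = \<sigma> ` (fn P - {y1, y2})"
  define z1 where "z1 = pick y1 F"
  define z2 where "z2 = pick y2 (insert z1 F)"
  have "weighs (E'(z1 := A, z2 := B)) (subst (\<sigma>(y1 := z1, y2 := z2)) P) M"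
    using weighs_Srv.prems pick_binders[OF finite_fn F_def z1_def z2_def, where E' = E']
    by (intro weighs_Srv.IH) auto
  moreover have "E' (\<sigma> x) = Chan n A B" using weighs_Srv by simp
  ultimately show ?case
    unfolding subst.simps Let_def F_def[symmetric] z1_def[symmetric] z2_def[symmetric]
    using weighs_Srv.hyps by (blast intro: weighs.weighs_Srv)
qed (auto intro: weighs.intros)

text \<open>The converse is required because \<alpha>-equivalence is symmetric. The induction is on
  \<open>P\<close>, whose constructors determine those of \<open>subst \<sigma> P\<close>; the sorts
  of binders are taken from the given derivation.\<close>

lemma weighs_subst_rev:
  assumes "weighs E' (subst \<sigma> P) M" and "\<forall>x \<in> fn P. fits (E x) (E' (\<sigma> x))"
  shows "weighs E P M"
  using assms
proof (induction P arbitrary: E E' \<sigma> M)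
  case (Out x y1 y2 P)
  from Out.prems(1) obtain n A B N where *: "E' (\<sigma> x) = Chan n A B" "fits (E' (\<sigma> y1)) A"
    "fits (E' (\<sigma> y2)) B" "weighs E' (subst \<sigma> P) N" "M = add_mset n N"
    by (auto elim: weighs_OutE)
  moreover have "weighs E P N" using Out * by auto
  ultimately show ?case
    using Out.prems(2) by (auto intro!: weighs_Out[of _ _ _ A B] intro: fits_trans)
next
  case (In x y1 y2 P)
  define F where "F = \<sigma> ` (fn P - {y1, y2})"
  define z1 where "z1 = pick y1 F"
  define z2 where "z2 = pick y2 (insert z1 F)"
  from In.prems(1) obtain n A B where *: "E' (\<sigma> x) = Chan n A B"
    "weighs (E'(z1 := A, z2 := B)) (subst (\<sigma>(y1 := z1, y2 := z2)) P) M"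
    unfolding subst.simps Let_def F_def[symmetric] z1_def[symmetric] z2_def[symmetric]
    by (auto elim: weighs_InE)
  have "weighs (E(y1 := A, y2 := B)) P M"
    using In.prems(2) pick_binders[OF finite_fn F_def z1_def z2_def, where E' = E']
    by (intro In.IH[OF *(2)]) auto
  moreover have "E x = Chan n A B" using In.prems(2) * by simp
  ultimately show ?case by (blast intro: weighs_In)
next
  case (Srv x y1 y2 P)
  define F where "F = \<sigma> ` (fn P - {y1, y2})"
  define z1 where "z1 = pick y1 F"
  define z2 where "z2 = pick y2 (insert z1 F)"
  from Srv.prems(1) obtain n A B N where *: "E' (\<sigma> x) = Chan n A B"
    "weighs (E'(z1 := A, z2 := B)) (subst (\<sigma>(y1 := z1, y2 := z2)) P) N"
    "\<forall>m \<in># N. m < n" "M = {#}"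
    unfolding subst.simps Let_def F_def[symmetric] z1_def[symmetric] z2_def[symmetric]
    by (auto elim: weighs_SrvE)
  have "weighs (E(y1 := A, y2 := B)) P N"
    using Srv.prems(2) pick_binders[OF finite_fn F_def z1_def z2_def, where E' = E']
    by (intro Srv.IH[OF *(2)]) auto
  moreover have "E x = Chan n A B" using Srv.prems(2) * by simp
  ultimately show ?case using *(3,4) by (blast intro: weighs_Srv)
next
  case (Par P Q)
  then show ?case by (fastforce elim!: weighs_ParE intro!: weighs_Par)
next
  case (Res x P)
  define z where "z = pick x (\<sigma> ` (fn P - {x}))"
  from Res.prems(1) obtain S where *: "weighs (E'(z := S)) (subst (\<sigma>(x := z)) P) M"
    by (auto simp: z_def[symmetric] Let_def elim: weighs_ResE)
  have "weighs (E(x := S)) P M"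
    using Res.prems(2) pick_binder[OF finite_fn z_def, where E' = E' and S = S] by (intro Res.IH[OF *]) auto
  then show ?case by (rule weighs_Res)
next
  case PNil
  then show ?case by (auto elim: weighs_NilE intro: weighs_Nil)
qed

section \<open>Invariance under renaming of bound names\<close>

lemma weighs_subst_iff:
  assumes "\<forall>w \<in> fn P. E' (\<sigma> w) = E w"
  shows "weighs E' (subst \<sigma> P) M \<longleftrightarrow> weighs E P M"
proof
  show "weighs E P M" if "weighs E' (subst \<sigma> P) M"
    using that by (rule weighs_subst_rev) (simp add: assms)
  show "weighs E' (subst \<sigma> P) M" if "weighs E P M"
    using that by (rule weighs_subst) (simp add: assms)
qed

lemma weighs_subst2_iff:
  assumes "y1 \<noteq> y2" and "z1 \<noteq> z2" and "{z1, z2} \<inter> (fn P - {y1, y2}) = {}"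
  shows "weighs (E(z1 := A, z2 := B)) (subst2 P y1 y2 z1 z2) M
    \<longleftrightarrow> weighs (E(y1 := A, y2 := B)) P M"
  by (rule weighs_subst_iff) (use assms in auto)

lemma weighs_subst1_iff:
  assumes "z \<notin> fn P - {x}"
  shows "weighs (E(z := S)) (subst1 P x z) M \<longleftrightarrow> weighs (E(x := S)) P M"
  by (rule weighs_subst_iff) (use assms in auto)

text \<open>As an equivalence the claim passes through symmetry and transitivity; it is generalized
  over \<open>E\<close> because congruence under a binder extends the environment.\<close>

lemma weighs_alpha: "P \<approx>\<^sub>\<alpha> Q \<Longrightarrow> weighs E P M \<longleftrightarrow> weighs E Q M"
proof (induction arbitrary: E M rule: alpha.induct)
  case (rename_In y1 y2 z1 z2 P x)
  then show ?case
    by (auto elim!: weighs_InE intro!: weighs_In simp: weighs_subst2_iff)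
next
  case (rename_Srv y1 y2 z1 z2 P x)
  then show ?case
    by (auto elim!: weighs_SrvE intro!: weighs_Srv simp: weighs_subst2_iff)
next
  case (rename_Res z P x)
  then show ?case
    by (metis weighs_ResE weighs_Res weighs_subst1_iff)
next
  case (alpha_Out P Q x y1 y2)
  then show ?case by (auto elim!: weighs_OutE intro!: weighs_Out)
next
  case (alpha_In P Q x y1 y2)
  then show ?case by (auto elim!: weighs_InE intro!: weighs_In)
next
  case (alpha_Srv P Q x y1 y2)
  then show ?case by (auto elim!: weighs_SrvE intro!: weighs_Srv)
next
  case (alpha_Par P P' Q Q')
  then show ?case by (auto elim!: weighs_ParE intro!: weighs_Par)
next
  case (alpha_Res P Q x)
  then show ?case by (metis weighs_ResE weighs_Res)
qed auto

section \<open>Transitions\<close>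

text \<open>\<open>E'\<close> supplies the sorts at which the names in \<open>bs\<close> are bound
  again, one restriction at a time.\<close>

lemma weighs_Ress:
  assumes "weighs E' P M" and "\<And>z. z \<notin> set bs \<Longrightarrow> E' z = E z"
  shows "weighs E (Ress bs P) M"
  using assms
proof (induction bs arbitrary: E)
  case Nil
  then have "E' = E" by auto
  then show ?case using Nil by simp
next
  case (Cons b bs)
  have "weighs (E(b := E' b)) (Ress bs P) M"
    by (rule Cons.IH[OF Cons.prems(1)]) (use Cons.prems(2) in auto)
  then show ?case by (auto intro: weighs_Res)
qed

text \<open>The received names need not be declared in the sender's environment at exactly the sorts
  \<open>A\<close> and \<open>B\<close>, hence \<open>fits\<close>. The part \<open>K\<close> comes from the body of a server.\<close>

lemma weighs_input:
  assumes "P \<midarrow>a\<rightarrow> P'" and "a = LIn x v1 v2" and "weighs E P M"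
    and "E x = Chan n A B" and "fits (E v1) A" and "fits (E v2) B"
  shows "\<exists>K. weighs E P' (M + K) \<and> (\<forall>k \<in># K. k < n)"
  using assms
proof (induction arbitrary: E M rule: trans.induct)
  case (tr_in x' y1 y2 P v1' v2')
  then have "weighs (E(y1 := A, y2 := B)) P M" by (auto elim!: weighs_InE)
  then have "weighs E (subst2 P y1 y2 v1 v2) M" using tr_in by (auto intro: weighs_subst)
  \<comment> \<open>A linear input releases nothing new: the active outputs of its body are already
    counted in \<open>M\<close>.\<close>
  then show ?case using tr_in by (intro exI[of _ "{#}"]) auto
next
  case (tr_srv x' y1 y2 P v1' v2')
  then obtain K where K: "weighs (E(y1 := A, y2 := B)) P K" "\<forall>k \<in># K. k < n" and "M = {#}"
    by (auto elim!: weighs_SrvE)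
  then have "weighs E (subst2 P y1 y2 v1 v2) K" using tr_srv by (auto intro: weighs_subst)
  \<comment> \<open>The server itself stays, with empty weight; the outputs of the spawned body only
    now become active and account for \<open>K\<close>.\<close>
  then have "weighs E (Par (Srv x' y1 y2 P) (subst2 P y1 y2 v1 v2)) (M + K)"
    using tr_srv.prems by (intro weighs_Par)
  then show ?case using tr_srv.prems K(2) by auto
next
  case (tr_parL P a P' Q)
  from tr_parL.prems obtain M1 N where MN: "weighs E P M1" "weighs E Q N" "M = M1 + N"
    by (auto elim!: weighs_ParE)
  then obtain K where "weighs E P' (M1 + K)" "\<forall>k \<in># K. k < n"
    using tr_parL by blast
  then show ?case using MN weighs_Par[of E P' "M1 + K" Q N] by (auto simp: ac_simps)
next
  case (tr_parR Q a Q' P)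
  from tr_parR.prems obtain M1 N where MN: "weighs E P M1" "weighs E Q N" "M = M1 + N"
    by (auto elim!: weighs_ParE)
  then obtain K where "weighs E Q' (N + K)" "\<forall>k \<in># K. k < n"
    using tr_parR by blast
  then show ?case using MN weighs_Par[of E P M1 Q' "N + K"] by (auto simp: ac_simps)
next
  case (tr_res P a P' z)
  from tr_res.prems obtain S where "weighs (E(z := S)) P M" by (auto elim!: weighs_ResE)
  moreover have "(E(z := S)) x = Chan n A B" "fits ((E(z := S)) v1) A" "fits ((E(z := S)) v2) B"
    using tr_res.hyps(2) tr_res.prems by auto
  ultimately obtain K where "weighs (E(z := S)) P' (M + K)" "\<forall>k \<in># K. k < n"
    using tr_res.IH[OF tr_res.prems(1)] by blast
  then show ?case by (auto intro: weighs_Res)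
next
  case (tr_alpha P Q a Q')
  then show ?case using weighs_alpha[OF tr_alpha.hyps(1)] by blast
qed auto

text \<open>The residual has left the scope of the restrictions on \<open>bs\<close>, so it is
  weighed in an \<open>E'\<close> that holds the sorts at which these names were bound. The only
  loss is the consumed prefix, of level \<open>n\<close>.\<close>

lemma weighs_output:
  assumes "P \<midarrow>a\<rightarrow> P'" and "a = LOut bs x v1 v2" and "weighs E P M"
  shows "\<exists>E' n A B M'. (\<forall>z. z \<notin> set bs \<longrightarrow> E' z = E z) \<and> E' x = Chan n A B \<and>
    fits (E' v1) A \<and> fits (E' v2) B \<and> weighs E' P' M' \<and> M = add_mset n M'"
  using assms
proof (induction arbitrary: E M bs rule: trans.induct)
  case (tr_out x' y1 y2 P)
  then show ?case by (auto elim!: weighs_OutE)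
next
  case (tr_parL P a P' Q)
  from tr_parL.prems obtain M1 N where MN: "weighs E P M1" "weighs E Q N" "M = M1 + N"
    by (auto elim!: weighs_ParE)
  then obtain E' n A B M' where *: "\<forall>z. z \<notin> set bs \<longrightarrow> E' z = E z" "E' x = Chan n A B"
    "fits (E' v1) A" "fits (E' v2) B" "weighs E' P' M'" "M1 = add_mset n M'"
    using tr_parL.IH[OF tr_parL.prems(1), of E M1] by blast
  \<comment> \<open>The extruded names are not free in \<open>Q\<close>, so \<open>E\<close> and
    \<open>E'\<close> agree on what \<open>Q\<close> uses.\<close>
  moreover have "weighs E' Q N"
    by (rule weighs_cong[OF MN(2)]) (use *(1) tr_parL.hyps(2) tr_parL.prems(1) in auto)
  ultimately have "weighs E' (Par P' Q) (M' + N)" "M = add_mset n (M' + N)"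
    using MN by (auto intro: weighs_Par)
  then show ?case using * by blast
next
  case (tr_parR Q a Q' P)
  from tr_parR.prems obtain M1 N where MN: "weighs E P M1" "weighs E Q N" "M = M1 + N"
    by (auto elim!: weighs_ParE)
  then obtain E' n A B N' where *: "\<forall>z. z \<notin> set bs \<longrightarrow> E' z = E z" "E' x = Chan n A B"
    "fits (E' v1) A" "fits (E' v2) B" "weighs E' Q' N'" "N = add_mset n N'"
    using tr_parR.IH[OF tr_parR.prems(1), of E N] by blast
  moreover have "weighs E' P M1"
    by (rule weighs_cong[OF MN(1)]) (use *(1) tr_parR.hyps(2) tr_parR.prems(1) in auto)
  ultimately have "weighs E' (Par P Q') (M1 + N')" "M = add_mset n (M1 + N')"
    using MN by (auto intro: weighs_Par)
  then show ?case using * by blast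
next
  case (tr_res P a P' z)
  from tr_res.prems obtain S where "weighs (E(z := S)) P M" by (auto elim!: weighs_ResE)
  from tr_res.IH[OF tr_res.prems(1) this] obtain E' n A B M' where *: "\<forall>w. w \<notin> set bs \<longrightarrow> E' w = (E(z := S)) w"
    "E' x = Chan n A B" "fits (E' v1) A" "fits (E' v2) B" "weighs E' P' M'" "M = add_mset n M'"
    by (elim exE conjE) (rule that)
  have z: "z \<notin> set bs" "z \<noteq> x" "z \<noteq> v1" "z \<noteq> v2" using tr_res.hyps(2) tr_res.prems(1) by auto
  \<comment> \<open>\<open>z\<close> stays restricted: outside, its sort is reset to
    \<open>E z\<close>, and binding it at \<open>S\<close> recovers \<open>E'\<close>.\<close>
  have "E' z = S" using *(1) z(1) by simp
  then have "(E'(z := E z))(z := S) = E'" by (simp add: fun_upd_idem)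
  then have "weighs (E'(z := E z)) (Res z P') M'" using *(5) by (intro weighs_Res[where S = S]) simp
  moreover have "\<forall>w. w \<notin> set bs \<longrightarrow> (E'(z := E z)) w = E w" using *(1) by auto
  moreover have "(E'(z := E z)) x = Chan n A B" "fits ((E'(z := E z)) v1) A"
    "fits ((E'(z := E z)) v2) B" using *(2-4) z by auto
  ultimately show ?case using *(6) by (intro exI conjI)
next
  case (tr_open P bs' x' v1' v2' P' y)
  have eq: "bs = y # bs'" "LOut bs' x' v1' v2' = LOut bs' x v1 v2"
    using tr_open.prems(1) by auto
  from tr_open.prems obtain S where "weighs (E(y := S)) P M" by (auto elim!: weighs_ResE)
  from tr_open.IH[OF eq(2) this] obtain E' n A B M' where *: "\<forall>w. w \<notin> set bs' \<longrightarrow> E' w = (E(y := S)) w"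
    "E' x = Chan n A B" "fits (E' v1) A" "fits (E' v2) B" "weighs E' P' M'" "M = add_mset n M'"
    by (elim exE conjE) (rule that)
  \<comment> \<open>The deviation of \<open>E'\<close> from \<open>E\<close> at \<open>y\<close> is
    allowed here, since \<open>y\<close> has joined the extruded names.\<close>
  moreover have "\<forall>w. w \<notin> set bs \<longrightarrow> E' w = E w" using *(1) eq(1) by auto
  ultimately show ?case by (intro exI conjI)
next
  case (tr_alpha P Q a Q')
  then show ?case using weighs_alpha[OF tr_alpha.hyps(1)] by blast
qed auto

text \<open>As the extruded names are not free in \<open>Q\<close>, one \<open>E'\<close> serves
  sender and receiver.\<close>

lemma weighs_com:
  assumes "P \<midarrow>LOut bs x v1 v2\<rightarrow> P'" and "Q \<midarrow>LIn x v1 v2\<rightarrow> Q'" and "set bs \<inter> fn Q = {}"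
    and "weighs E P M" and "weighs E Q N"
  shows "\<exists>E' M' N'. (\<forall>z. z \<notin> set bs \<longrightarrow> E' z = E z) \<and> weighs E' P' M' \<and> weighs E' Q' N' \<and>
    (M' + N', M + N) \<in> mult less_than"
proof -
  from weighs_output[OF assms(1) refl assms(4)] obtain E' n A B M'
    where *: "\<forall>z. z \<notin> set bs \<longrightarrow> E' z = E z" "E' x = Chan n A B"
    "fits (E' v1) A" "fits (E' v2) B" "weighs E' P' M'" "M = add_mset n M'" by (elim exE conjE) (rule that)
  have "weighs E' Q N"
    by (rule weighs_cong[OF assms(5)]) (use assms(3) *(1) in auto)
  from weighs_input[OF assms(2) refl this *(2-4)] obtain K
    where K: "weighs E' Q' (N + K)" "\<forall>k \<in># K. k < n" by (elim exE conjE) (rule that)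
  \<comment> \<open>\<open>M' + N\<close> is kept, and the single \<open>n\<close> of the consumed
    prefix is traded for the possibly empty \<open>K\<close>, all below \<open>n\<close>.\<close>
  have "((M' + N) + K, (M' + N) + {#n#}) \<in> mult less_than"
    using K(2) by (intro one_step_implies_mult) auto
  then have "(M' + (N + K), M + N) \<in> mult less_than"
    using *(6) by (simp add: add.assoc)
  then show ?thesis using *(1,5) K(1) by (intro exI conjI)
qed

section \<open>Strict decrease and termination\<close>

lemma mult_less_than_add: "(M', M) \<in> mult less_than \<Longrightarrow> (M' + N, M + N) \<in> mult less_than"
  by (simp add: mult_cancel trans_less_than irrefl_on_def)

text \<open>The drop happens at communication; a parallel component adds the same part to both
  sides, and restriction and renaming keep the weight. The environment stays \<open>E\<close>,
  because the extruded names are restricted again.\<close>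

lemma weighs_Tau:
  assumes "P \<midarrow>a\<rightarrow> P'" and "a = Tau" and "weighs E P M"
  shows "\<exists>M'. weighs E P' M' \<and> (M', M) \<in> mult less_than"
  using assms
proof (induction arbitrary: E M rule: trans.induct)
  case (tr_parL P a P' Q)
  from tr_parL.prems obtain M1 N where MN: "weighs E P M1" "weighs E Q N" "M = M1 + N"
    by (auto elim!: weighs_ParE)
  then obtain M' where "weighs E P' M'" "(M', M1) \<in> mult less_than" using tr_parL by blast
  then show ?case using MN by (blast intro: weighs_Par mult_less_than_add)
next
  case (tr_parR Q a Q' P)
  from tr_parR.prems obtain M1 N where MN: "weighs E P M1" "weighs E Q N" "M = M1 + N"
    by (auto elim!: weighs_ParE)
  then obtain N' where "weighs E Q' N'" "(N', N) \<in> mult less_than" using tr_parR by blast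
  then have "weighs E (Par P Q') (M1 + N')" "(M1 + N', M1 + N) \<in> mult less_than"
    using MN mult_less_than_add[of N' N M1] by (auto simp: add.commute intro: weighs_Par)
  then show ?case using MN by blast
next
  case (tr_res P a P' z)
  then show ?case by (metis weighs_Res weighs_ResE)
next
  case (tr_comL P bs x v1 v2 P' Q Q')
  from tr_comL.prems obtain M1 N where MN: "weighs E P M1" "weighs E Q N" "M = M1 + N"
    by (auto elim!: weighs_ParE)
  from weighs_com[OF tr_comL.hyps MN(1,2)] obtain E' M' N'
    where "\<forall>z. z \<notin> set bs \<longrightarrow> E' z = E z" "weighs E' P' M'" "weighs E' Q' N'"
      and less: "(M' + N', M) \<in> mult less_than"
    using MN(3) by (elim exE conjE) simp
  then have "weighs E (Ress bs (Par P' Q')) (M' + N')"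
    by (intro weighs_Ress[of E'] weighs_Par) auto
  then show ?case using less by (intro exI conjI)
next
  case (tr_comR P x v1 v2 P' Q bs Q')
  from tr_comR.prems obtain M1 N where MN: "weighs E P M1" "weighs E Q N" "M = M1 + N"
    by (auto elim!: weighs_ParE)
  from weighs_com[OF tr_comR.hyps(2,1,3) MN(2,1)] obtain E' M' N'
    where "\<forall>z. z \<notin> set bs \<longrightarrow> E' z = E z" "weighs E' Q' M'" "weighs E' P' N'"
      and less: "(N' + M', M) \<in> mult less_than"
    using MN(3) by (elim exE conjE) (simp add: add.commute)
  then have "weighs E (Ress bs (Par P' Q')) (N' + M')"
    by (intro weighs_Ress[of E'] weighs_Par) auto
  then show ?case using less by (intro exI conjI)
next
  case (tr_alpha P Q a Q')
  then show ?case using weighs_alpha[OF tr_alpha.hyps(1)] by blast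
qed auto

text \<open>\<open>mult less_than\<close> is the Dershowitz-Manna order, well-founded because the
  order on levels is.\<close>

lemma weighs_terminates: "weighs E P M \<Longrightarrow> terminates P"
proof (induction M arbitrary: P rule: wf_induct_rule[OF wf_mult[OF wf_less_than]])
  case (1 M)
  show ?case unfolding terminates_def
  proof
    assume "\<exists>f :: nat \<Rightarrow> proc. f 0 = P \<and> (\<forall>i. f i \<midarrow>Tau\<rightarrow> f (Suc i))"
    then obtain f :: "nat \<Rightarrow> proc" where f: "f 0 = P" "\<And>i. f i \<midarrow>Tau\<rightarrow> f (Suc i)" by blast
    obtain M' where "weighs E (f 1) M'" "(M', M) \<in> mult less_than"
      using weighs_Tau[OF f(2)[of 0] refl] f(1) 1(2) by auto
    then have "terminates (f 1)" using 1(1) by blast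
    moreover have "\<exists>g :: nat \<Rightarrow> proc. g 0 = f 1 \<and> (\<forall>i. g i \<midarrow>Tau\<rightarrow> g (Suc i))"
      using f(2) by (intro exI[of _ "\<lambda>i. f (Suc i)"]) simp
    ultimately show False unfolding terminates_def by (rule notE)
  qed
qed

section \<open>Typed processes\<close>

text \<open>This lets both endpoints of a channel share one sort in an environment.\<close>

lemma sort_of_dual [simp]: "sort_of (dual V) = sort_of V"
  by (induction V) auto

text \<open>A relation, not a function: the unordered pair in \<open>Both V\<close> gives a type
  only up to duality, and a pair of types not dual to each other gives none.\<close>

definition entry_ty :: "entry \<Rightarrow> ty \<Rightarrow> bool" where
  "entry_ty e V \<longleftrightarrow> e = One V \<or> e = Both V"

lemma entry_ty_One [simp]: "entry_ty (One V) W \<longleftrightarrow> W = V"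
  by (auto simp: entry_ty_def)

lemma entry_ty_Both: "entry_ty (Both V) W \<Longrightarrow> sort_of W = sort_of V"
  by (auto simp: entry_ty_def)

text \<open>With \<open>fits\<close>, a context may hold at \<open>UnitT\<close> a name that the
  environment knows as a channel, as happens to \<open>y2\<close> in \<open>Un_Out1\<close> and
  \<open>Un_Out2\<close>.\<close>

definition env_fits :: "env \<Rightarrow> ctx \<Rightarrow> bool" where
  "env_fits E \<Gamma> \<longleftrightarrow>
    (\<forall>x e V. fmlookup \<Gamma> x = Some e \<longrightarrow> entry_ty e V \<longrightarrow> fits (E x) (sort_of V))"

lemma env_fits_One:
  "env_fits E \<Gamma> \<Longrightarrow> fits S (sort_of V) \<Longrightarrow> env_fits (E(x := S)) (\<Gamma> \<lhd> x \<mapsto> V)"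
  by (auto simp: env_fits_def)

lemma env_fits_Both:
  "env_fits E \<Gamma> \<Longrightarrow> fits S (sort_of V) \<Longrightarrow> env_fits (E(x := S)) (\<Gamma> \<lhd> x \<mapsto>\<^sub>2 V)"
  by (auto simp: env_fits_def dest: entry_ty_Both)

lemma env_fits_One_same: "env_fits E \<Gamma> \<Longrightarrow> fits (E x) (sort_of V) \<Longrightarrow> env_fits E (\<Gamma> \<lhd> x \<mapsto> V)"
  using env_fits_One[of E \<Gamma> "E x" V x] by simp

lemma env_fits_Both_same: "env_fits E \<Gamma> \<Longrightarrow> fits (E x) (sort_of V) \<Longrightarrow> env_fits E (\<Gamma> \<lhd> x \<mapsto>\<^sub>2 V)"
  using env_fits_Both[of E \<Gamma> "E x" V x] by simp

lemma env_fits_OneD: "env_fits E (\<Gamma> \<lhd> x \<mapsto> V) \<Longrightarrow> fits (E x) (sort_of V)"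
  by (auto simp: env_fits_def)

lemma env_fits_BothD: "env_fits E (\<Gamma> \<lhd> x \<mapsto>\<^sub>2 V) \<Longrightarrow> fits (E x) (sort_of V)"
  by (auto simp: env_fits_def entry_ty_def)

text \<open>Freshness of \<open>x\<close> ensures that the update hides no demand of an older
  entry.\<close>

lemma env_fits_drop:
  assumes "env_fits E (fmupd x e \<Gamma>)" and "new [x] \<Gamma>"
  shows "env_fits E \<Gamma>"
  unfolding env_fits_def
proof (intro allI impI)
  fix y e' V
  assume *: "fmlookup \<Gamma> y = Some e'" "entry_ty e' V"
  then have "y \<noteq> x" using assms(2) fmdom'I[of \<Gamma> y e'] by (auto simp: new_def)
  then show "fits (E y) (sort_of V)" using assms(1) * by (auto simp: env_fits_def)
qed

text \<open>Splitting copies an entry, sends it to one side, or deals one endpoint to each side;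
  dual endpoints have the same sort, so neither half demands more than the whole.\<close>

lemma env_fits_split: "split \<Gamma> \<Gamma>1 \<Gamma>2 \<Longrightarrow> env_fits E \<Gamma> \<Longrightarrow> env_fits E \<Gamma>1 \<and> env_fits E \<Gamma>2"
  by (induction rule: split.induct)
    (auto intro!: env_fits_One_same env_fits_Both_same dest: env_fits_drop env_fits_OneD env_fits_BothD)

lemma env_fits_split3:
  "split3 \<Gamma> \<Gamma>1 \<Gamma>2 \<Gamma>3 \<Longrightarrow> env_fits E \<Gamma> \<Longrightarrow> env_fits E \<Gamma>1 \<and> env_fits E \<Gamma>2 \<and> env_fits E \<Gamma>3"
  unfolding split3_def using env_fits_split by blast

lemma typed_name_level:
  assumes "typed_name l \<Gamma> x V" and "level_of V = Some n"
  shows "l x = n"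
  using assms
proof (induction rule: typed_name.induct)
  case (Var1 \<Gamma> x V)
  then show ?case unfolding levels_def by (metis fmupd_lookup)
next
  case (Var2 \<Gamma> x V)
  then show ?case unfolding levels_def by (metis fmupd_lookup)
qed

text \<open>The inclusion in the levels of \<open>os P\<close> turns the side condition of
  \<open>Un_In1\<close> and \<open>Un_In2\<close>, stated through \<open>l\<close>, into that of
  \<open>weighs_Srv\<close>, stated through weights.\<close>

lemma typed_weighs:
  assumes "typed l \<Gamma> P" and "env_fits E \<Gamma>"
  shows "\<exists>M. weighs E P M \<and> set_mset M \<subseteq> l ` os P"
  using assms
proof (induction arbitrary: E rule: typed.induct)
  case (T_Nil \<Gamma>)
  then show ?case using weighs_Nil by force
next
  case (T_Par \<Gamma>1 P \<Gamma>2 Q \<Gamma>)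
  then obtain M N where "weighs E P M" "set_mset M \<subseteq> l ` os P" "weighs E Q N"
    "set_mset N \<subseteq> l ` os Q" using env_fits_split by meson
  then show ?case by (intro exI[of _ "M + N"]) (auto intro: weighs_Par)
next
  case (T_Res x \<Gamma> V P)
  then have "env_fits (E(x := sort_of V)) (\<Gamma> \<lhd> x \<mapsto>\<^sub>2 V)" by (simp add: env_fits_Both)
  then show ?case using T_Res.IH by (fastforce intro: weighs_Res)
next
  case (Lin_In1 x \<Gamma>1 y1 y2 \<Gamma>2 n V1 V2 P \<Gamma>)
  note c = env_fits_split[OF Lin_In1.hyps(6) Lin_In1.prems]
  have "env_fits (E(y1 := sort_of V1, y2 := sort_of V2)) (\<Gamma>2 \<lhd> y1 \<mapsto> V1 \<lhd> y2 \<mapsto> V2)"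
    using c by (simp add: env_fits_One)
  moreover have "E x = Chan (nat_of_weight n) (sort_of V1) (sort_of V2)"
    using c env_fits_OneD by fastforce
  ultimately show ?case using Lin_In1.IH by (fastforce intro: weighs_In)
next
  case (Lin_In2 x \<Gamma>1 y1 y2 \<Gamma>2 n V P \<Gamma>)
  note c = env_fits_split[OF Lin_In2.hyps(5) Lin_In2.prems]
  have "env_fits (E(y1 := sort_of V, y2 := Unit))
      (\<Gamma>2 \<lhd> x \<mapsto> ServerT n V \<lhd> y1 \<mapsto> V \<lhd> y2 \<mapsto> UnitT)"
    using c by (simp add: env_fits_One)
  moreover have "E x = Chan (nat_of_weight n) (sort_of V) Unit"
    using c env_fits_OneD by fastforce
  ultimately show ?case using Lin_In2.IH by (fastforce intro: weighs_In)
next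
  case (Lin_In3 x y1 y2 \<Gamma> n V P)
  have "env_fits (E(y1 := sort_of V, y2 := Unit))
      (\<Gamma> \<lhd> x \<mapsto>\<^sub>2 ServerT n V \<lhd> y1 \<mapsto> V \<lhd> y2 \<mapsto> UnitT)"
    using Lin_In3.prems by (intro env_fits_One) auto
  moreover have "E x = Chan (nat_of_weight n) (sort_of V) Unit"
    using env_fits_BothD[OF Lin_In3.prems] by simp
  ultimately show ?case using Lin_In3.IH by (fastforce intro: weighs_In)
next
  case (Lin_Out x \<Gamma>1 y1 \<Gamma>2 y2 \<Gamma>3 n V1 V2 P \<Gamma>)
  note c = env_fits_split3[OF Lin_Out.hyps(8) Lin_Out.prems]
  have y2: "fits (E y2) (sort_of V2)" using c env_fits_BothD by blast
  \<comment> \<open>The split context holds both endpoints of \<open>y2\<close>, the continuation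
    only one; their sorts agree.\<close>
  then have "env_fits E (\<Gamma>3 \<lhd> y2 \<mapsto> V2)"
    using c Lin_Out.hyps(3) env_fits_drop env_fits_One_same by blast
  then obtain M where M: "weighs E P M" "set_mset M \<subseteq> l ` os P" using Lin_Out.IH by blast
  have "E x = Chan (nat_of_weight n) (sort_of V1) (sort_of V2)" "fits (E y1) (sort_of V1)"
    using c by (auto dest: env_fits_OneD)
  then have "weighs E (Out x y1 y2 P) (add_mset (nat_of_weight n) M)"
    using y2 M(1) by (rule weighs_Out)
  \<comment> \<open>The weight in the sort of \<open>x\<close> equals \<open>l x\<close>, so the
    added element is the level of a name in \<open>os\<close>.\<close>
  moreover have "l x = nat_of_weight n" using typed_name_level[OF Lin_Out.hyps(4)] by simp
  ultimately show ?case using M(2) by fastforce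
next
  case (Un_Out1 x \<Gamma>1 y1 \<Gamma>2 y2 \<Gamma>3 n V P \<Gamma>)
  note c = env_fits_split3[OF Un_Out1.hyps(7) Un_Out1.prems]
  \<comment> \<open>\<open>y2\<close> is demanded at \<open>Unit\<close> only, so \<open>E\<close>
    needs no change there.\<close>
  have "env_fits E (\<Gamma>3 \<lhd> x \<mapsto> ClientT n V \<lhd> y2 \<mapsto> UnitT)"
    using c by (simp add: env_fits_One_same)
  then obtain M where M: "weighs E P M" "set_mset M \<subseteq> l ` os P" using Un_Out1.IH by blast
  have "E x = Chan (nat_of_weight n) (sort_of V) Unit" "fits (E y1) (sort_of V)"
    using c by (auto dest: env_fits_OneD)
  then have "weighs E (Out x y1 y2 P) (add_mset (nat_of_weight n) M)"
    using fits_Unit M(1) by (rule weighs_Out)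
  moreover have "l x = nat_of_weight n" using typed_name_level[OF Un_Out1.hyps(4)] by simp
  ultimately show ?case using M(2) by fastforce
next
  case (Un_Out2 x \<Gamma>1 y1 \<Gamma>2 y2 \<Gamma>3 n V P \<Gamma>)
  note c = env_fits_split3[OF Un_Out2.hyps(7) Un_Out2.prems]
  have "env_fits E (\<Gamma>3 \<lhd> x \<mapsto>\<^sub>2 ClientT n V \<lhd> y2 \<mapsto> UnitT)"
    using c by (intro env_fits_One_same) auto
  then obtain M where M: "weighs E P M" "set_mset M \<subseteq> l ` os P" using Un_Out2.IH by blast
  have "fits (E x) (sort_of (ClientT n V))" and y1: "fits (E y1) (sort_of V)"
    using c env_fits_BothD env_fits_OneD by blast+
  then have "E x = Chan (nat_of_weight n) (sort_of V) Unit" by simp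
  then have "weighs E (Out x y1 y2 P) (add_mset (nat_of_weight n) M)"
    using y1 fits_Unit M(1) by (rule weighs_Out)
  moreover have "l x = nat_of_weight n" using typed_name_level[OF Un_Out2.hyps(4)] by simp
  ultimately show ?case using M(2) by fastforce
next
  case (Un_In1 x y1 y2 \<Gamma> n V P)
  have "env_fits (E(y1 := sort_of V, y2 := Unit))
      (\<Gamma> \<lhd> x \<mapsto> ServerT n V \<lhd> y1 \<mapsto> V \<lhd> y2 \<mapsto> UnitT)"
    using Un_In1.prems by (intro env_fits_One) auto
  then obtain M where "weighs (E(y1 := sort_of V, y2 := Unit)) P M" "set_mset M \<subseteq> l ` os P"
    using Un_In1.IH by blast
  moreover have "E x = Chan (nat_of_weight n) (sort_of V) Unit"
    using env_fits_OneD[OF Un_In1.prems] by simp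
  ultimately show ?case using Un_In1.hyps(4) by (fastforce intro: weighs_Srv)
next
  case (Un_In2 x y1 y2 \<Gamma> n V P)
  have "env_fits (E(y1 := sort_of V, y2 := Unit))
      (\<Gamma> \<lhd> x \<mapsto>\<^sub>2 ServerT n V \<lhd> y1 \<mapsto> V \<lhd> y2 \<mapsto> UnitT)"
    using Un_In2.prems by (intro env_fits_One) auto
  then obtain M where "weighs (E(y1 := sort_of V, y2 := Unit)) P M" "set_mset M \<subseteq> l ` os P"
    using Un_In2.IH by blast
  moreover have "E x = Chan (nat_of_weight n) (sort_of V) Unit"
    using env_fits_BothD[OF Un_In2.prems] by simp
  ultimately show ?case using Un_In2.hyps(4) by (fastforce intro: weighs_Srv)
qed

text \<open>The choice may return either of two dual types of an entry, which have the same sort;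
  where an entry has no type, the demand is vacuous.\<close>

lemma ex_env_fits: "\<exists>E. env_fits E \<Gamma>"
proof -
  have "env_fits (\<lambda>x. sort_of (SOME V. \<exists>e. fmlookup \<Gamma> x = Some e \<and> entry_ty e V)) \<Gamma>"
    unfolding env_fits_def
  proof (intro allI impI)
    fix x e V
    assume *: "fmlookup \<Gamma> x = Some e" "entry_ty e V"
    then have "entry_ty e (SOME V. \<exists>e. fmlookup \<Gamma> x = Some e \<and> entry_ty e V)"
      using someI[of "entry_ty e" V] by simp
    then have "sort_of (SOME V. \<exists>e. fmlookup \<Gamma> x = Some e \<and> entry_ty e V) = sort_of V"
      using *(2) by (metis entry_ty_Both entry_ty_One entry_ty_def)
    then show "fits (sort_of (SOME V. \<exists>e. fmlookup \<Gamma> x = Some e \<and> entry_ty e V)) (sort_of V)"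
      by simp
  qed
  then show ?thesis by blast
qed

theorem mainTheorem3:
  fixes \<Gamma> :: ctx and P :: proc
  assumes "\<Gamma> \<turnstile>\<^sub>w P"
  shows "terminates P"
proof -
  obtain P' l where P': "P \<approx>\<^sub>\<alpha> P'" "typed l \<Gamma> P'" using assms unfolding typable_def by blast
  obtain E where "env_fits E \<Gamma>" using ex_env_fits by blast
  then obtain M where "weighs E P' M" using typed_weighs[OF P'(2)] by blast
  \<comment> \<open>The typing derivation concerns the representative \<open>P'\<close>; its weight
    is carried back to \<open>P\<close>.\<close>
  then have "weighs E P M" using weighs_alpha[OF P'(1)] by blast
  then show ?thesis by (rule weighs_terminates)
qed

end
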